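(* Let $K\subset\mathbb{R}^d$ be a closed convex set containing a neighbourhood of the origin. The continued fraction $$F_n=[\underbrace{K,\dots,K}_{n}],\qquad n\ge1,$$ with constant term $K$ converges in the Hausdorff metric if and only if $F_{2k-1}\subset aB$ for some $a<1$ and at least one $k\ge1$.
   Context: $\mathcal{C}_0$ is the family of all convex closed sets in $\mathbb{R}^d$ containing the origin. $B$ is the unit Euclidean ball centred at the origin. Inclusions are non-strict. $K+L$ is the closed Minkowski sum, i.e. the closure of $\{x+y: x\in K, y\in L\}$. The polar of $K\in\mathcal{C}_0$ is $K^*=\{u\in\mathbb{R}^d: \langle u,x\rangle\le1\text{ for all }x\in K\}$. The Hausdorff distance is $\rho_H(K,L)=\inf\{\varepsilon>0: K\subset L+\varepsilon B,\ L\subset K+\varepsilon B\}$. Approximants are defined by $[K_1]=K_1^*$ and $[K_1,\dots,K_{n+1}]=(K_1+[K_2,\dots,K_{n+1}])^*$, $n\ge1$. Convergence means that there is $F\in\mathcal{C}_0$ with $\rho_H(F_n,F)\to0$. *)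

theory Defs
  imports "HOL-Analysis.Analysis"
begin

definition C0 :: "'a::euclidean_space set set" where
  "C0 = {K. convex K \<and> closed K \<and> 0 \<in> K}"

definition msum :: "'a::euclidean_space set \<Rightarrow> 'a set \<Rightarrow> 'a set"
  where "msum K L = closure {x + y | x y. x \<in> K \<and> y \<in> L}"

definition polar :: "'a::euclidean_space set \<Rightarrow> 'a set" where
  "polar K = {u. \<forall>x\<in>K. u \<bullet> x \<le> 1}"

text \<open>The value is an extended real, so that the infimum over the empty set is infinity: sets in
  \<open>C0\<close> may be unbounded. For positive \<open>e\<close>, \<open>cball 0 e\<close> is the \<open>e\<close>-fold dilate of the unit ball.\<close>

definition hausdorff_dist :: "'a::euclidean_space set \<Rightarrow> 'a set \<Rightarrow> ereal" where
  "hausdorff_dist K L =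
    (INF e \<in> {e::real. e > 0 \<and> K \<subseteq> msum L (cball 0 e) \<and> L \<subseteq> msum K (cball 0 e)}. ereal e)"

definition hausdorff_convergent :: "(nat \<Rightarrow> 'a::euclidean_space set) \<Rightarrow> bool" where
  "hausdorff_convergent F \<longleftrightarrow> (\<exists>L\<in>C0. (\<lambda>n. hausdorff_dist (F n) L) \<longlonglongrightarrow> 0)"

text \<open>Approximants are only meaningful for nonempty lists; the empty list is left unspecified.\<close>

fun approximant :: "'a::euclidean_space set list \<Rightarrow> 'a set" where
  "approximant [K] = polar K"
| "approximant (K # L # Ls) = polar (msum K (approximant (L # Ls)))"

text \<open>Meaningful for \<open>n \<ge> 1\<close>; the unspecified value at \<open>0\<close> does not affect convergence.\<close>

definition const_cf :: "'a::euclidean_space set \<Rightarrow> nat \<Rightarrow> 'a set" where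
  "const_cf K n = approximant (replicate n K)"

end

theory Submission
  imports Defs
begin

text \<open>Write \<open>T L = (K + L)\<^sup>*\<close>, so that the continued fraction is the orbit \<open>T\<^sup>n {0}\<close>.
  The map \<open>T\<close> reverses inclusions and \<open>{0}\<close> lies in every iterate; hence the even iterates
  increase, the odd ones decrease, and each even iterate lies in each odd one. The sequence
  therefore converges, to the intersection of the odd iterates, as soon as the distance of
  consecutive iterates tends to zero (\<open>alternating_hausdorff_convergent\<close>).

  If an odd iterate lies in \<open>aB\<close> with \<open>a < 1\<close>, then so do all later ones. Between sets
  whose images lie in \<open>aB\<close> the map \<open>T\<close> contracts the Hausdorff distance by the factor \<open>a\<^sup>2\<close>
  (\<open>cf_step_contraction\<close>): enlarging \<open>L\<close> by \<open>\<epsilon>B\<close> raises the support function at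
  \<open>u\<close> by \<open>\<epsilon> |u| \<le> a\<epsilon>\<close>, so \<open>u\<close> need only be divided by \<open>1 + a\<epsilon>\<close>, which moves it by at
  most \<open>a\<^sup>2\<epsilon>\<close>. So consecutive iterates approach each other geometrically.

  Conversely, let \<open>rB \<subseteq> K\<close>. A limit \<open>F\<close> satisfies \<open>F = (K + F)\<^sup>*\<close>; pairing a point
  \<open>u\<close> of \<open>F\<close> with the points \<open>u\<close> of \<open>F\<close> and \<open>r u / |u|\<close> of \<open>K\<close> yields
  \<open>|u|\<^sup>2 + r |u| \<le> 1\<close>, which keeps \<open>|u|\<close> away from \<open>1\<close>. This estimate tolerates small
  errors, so it can be applied to two consecutive iterates close to each other in place of \<open>F\<close>
  (\<open>cf_step_norm_bound\<close>).\<close>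

section \<open>Polars and closed Minkowski sums\<close>

lemma zero_in_polar: "0 \<in> polar K"
  by (simp add: polar_def)

lemma closed_polar: "closed (polar (K::'a::euclidean_space set))"
proof -
  have "polar K = (\<Inter>x\<in>K. {u. x \<bullet> u \<le> 1})"
    by (auto simp: polar_def inner_commute)
  then show ?thesis
    by (auto intro!: closed_INT closed_halfspace_le)
qed

lemma convex_polar: "convex (polar (K::'a::euclidean_space set))"
proof -
  have "polar K = (\<Inter>x\<in>K. {u. x \<bullet> u \<le> 1})"
    by (auto simp: polar_def inner_commute)
  then show ?thesis
    by (auto intro!: convex_INT convex_halfspace_le)
qed

text \<open>Taking the closure of a set does not affect its polar, because half-spaces are closed.\<close>

lemma polar_msum:
  fixes K L :: "'a::euclidean_space set"
  shows "polar (msum K L) = {u. \<forall>x\<in>K. \<forall>y\<in>L. u \<bullet> x + u \<bullet> y \<le> 1}"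
proof -
  have "u \<in> polar (msum K L) \<longleftrightarrow> (\<forall>x\<in>K. \<forall>y\<in>L. u \<bullet> x + u \<bullet> y \<le> 1)" for u
  proof
    assume "u \<in> polar (msum K L)"
    moreover have "x + y \<in> msum K L" if "x \<in> K" "y \<in> L" for x y
      unfolding msum_def using that by (intro subsetD[OF closure_subset]) blast
    ultimately show "\<forall>x\<in>K. \<forall>y\<in>L. u \<bullet> x + u \<bullet> y \<le> 1"
      by (auto simp: polar_def simp flip: inner_add_right)
  next
    assume "\<forall>x\<in>K. \<forall>y\<in>L. u \<bullet> x + u \<bullet> y \<le> 1"
    then have "{x + y |x y. x \<in> K \<and> y \<in> L} \<subseteq> {z. u \<bullet> z \<le> 1}"
      by (auto simp: inner_add_right)
    then have "msum K L \<subseteq> {z. u \<bullet> z \<le> 1}"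
      unfolding msum_def by (intro closure_minimal closed_halfspace_le)
    then show "u \<in> polar (msum K L)"
      by (auto simp: polar_def)
  qed
  then show ?thesis by blast
qed

text \<open>The closure in a closed Minkowski sum is superfluous when one summand is closed and the
  other is a ball, because the latter is compact.\<close>

lemma mem_msum_cball:
  fixes L :: "'a::euclidean_space set"
  assumes "closed L"
  shows "x \<in> msum L (cball 0 e) \<longleftrightarrow> (\<exists>y\<in>L. dist x y \<le> e)"
proof -
  have "closed (\<Union>x\<in>L. \<Union>y\<in>cball 0 e. {x + y})"
    using closed_compact_sums[OF assms compact_cball] .
  moreover have "(\<Union>x\<in>L. \<Union>y\<in>cball 0 e. {x + y}) = {x + y |x y. x \<in> L \<and> y \<in> cball 0 e}"
    by blast
  ultimately have eq: "msum L (cball 0 e) = {x + y |x y. x \<in> L \<and> y \<in> cball 0 e}"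
    unfolding msum_def by (simp add: closure_closed)
  show ?thesis
  proof
    assume "x \<in> msum L (cball 0 e)"
    then show "\<exists>y\<in>L. dist x y \<le> e"
      unfolding eq by (auto simp: dist_norm intro!: bexI)
  next
    assume "\<exists>y\<in>L. dist x y \<le> e"
    then obtain y where "y \<in> L" "norm (x - y) \<le> e"
      by (auto simp: dist_norm)
    then have "x = y + (x - y) \<and> y \<in> L \<and> x - y \<in> cball 0 e"
      by simp
    then show "x \<in> msum L (cball 0 e)"
      unfolding eq by blast
  qed
qed

lemma hausdorff_dist_nonneg: "0 \<le> hausdorff_dist K L"
  unfolding hausdorff_dist_def by (intro INF_greatest) auto

lemma hausdorff_dist_le:
  assumes "e > 0" "K \<subseteq> msum L (cball 0 e)" "L \<subseteq> msum K (cball 0 e)"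
  shows "hausdorff_dist K L \<le> ereal e"
  unfolding hausdorff_dist_def using assms by (intro INF_lower) auto

lemma hausdorff_dist_lessD:
  fixes K L :: "'a::euclidean_space set"
  assumes "hausdorff_dist K L < ereal e" "closed K" "closed L"
  shows "\<And>x. x \<in> K \<Longrightarrow> \<exists>y\<in>L. dist x y \<le> e" and "\<And>y. y \<in> L \<Longrightarrow> \<exists>x\<in>K. dist y x \<le> e"
proof -
  obtain d where d: "d < e" "K \<subseteq> msum L (cball 0 d)" "L \<subseteq> msum K (cball 0 d)"
    using assms(1) unfolding hausdorff_dist_def by (auto simp: INF_less_iff)
  show "\<exists>y\<in>L. dist x y \<le> e" if "x \<in> K" for x
    using that d mem_msum_cball[OF assms(3)] by (meson less_imp_le order_trans subsetD)
  show "\<exists>x\<in>K. dist y x \<le> e" if "y \<in> L" for y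
    using that d mem_msum_cball[OF assms(2)] by (meson less_imp_le order_trans subsetD)
qed

section \<open>The continued fraction as an orbit\<close>

definition cf_step :: "'a::euclidean_space set \<Rightarrow> 'a set \<Rightarrow> 'a set" where
  "cf_step K L = polar (msum K L)"

lemma cf_step_antimono: "L \<subseteq> M \<Longrightarrow> cf_step K M \<subseteq> cf_step K L"
  unfolding cf_step_def polar_msum by blast

lemma const_cf_eq_funpow:
  "const_cf K (Suc n) = (cf_step K ^^ Suc n) {0::'a::euclidean_space}"
proof (induction n)
  case 0
  show ?case
    by (simp add: const_cf_def cf_step_def polar_msum) (simp add: polar_def)
next
  case (Suc n)
  have "const_cf K (Suc (Suc n)) = cf_step K (const_cf K (Suc n))"
    by (simp add: const_cf_def cf_step_def)
  with Suc show ?case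
    by simp
qed

lemma funpow_cf_step_C0: "(cf_step K ^^ n) {0::'a::euclidean_space} \<in> C0"
  by (cases n) (auto simp: C0_def cf_step_def zero_in_polar closed_polar convex_polar)

text \<open>The case \<open>n = 0\<close> says that \<open>{0}\<close> lies in every iterate, and each step reverses inclusions.\<close>

lemma funpow_cf_step_alternating:
  fixes K :: "'a::euclidean_space set"
  defines "G \<equiv> \<lambda>n. (cf_step K ^^ n) {0}"
  shows "(even n \<longrightarrow> G n \<subseteq> G (n + j)) \<and> (odd n \<longrightarrow> G (n + j) \<subseteq> G n)"
proof (induction n)
  case 0
  show ?case
    using funpow_cf_step_C0[of j K] by (simp add: G_def C0_def)
next
  case (Suc n)
  have "G (Suc m) = cf_step K (G m)" for m :: nat
    by (simp add: G_def)
  with Suc show ?case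
    by (simp add: cf_step_antimono)
qed

section \<open>Convergence of alternating sequences\<close>

text \<open>The limit is the intersection of the odd terms. It contains all even terms, so it is squeezed
  between any two consecutive terms.\<close>

lemma alternating_hausdorff_convergent:
  fixes G :: "nat \<Rightarrow> 'a::euclidean_space set"
  assumes C0: "\<And>n. G n \<in> C0"
    and even: "\<And>n j. even n \<Longrightarrow> G n \<subseteq> G (n + j)"
    and odd: "\<And>n j. odd n \<Longrightarrow> G (n + j) \<subseteq> G n"
    and close: "\<And>n. n \<ge> N \<Longrightarrow> G (Suc n) \<subseteq> msum (G n) (cball 0 (e n))
                  \<and> G n \<subseteq> msum (G (Suc n)) (cball 0 (e n))"
    and e: "\<And>n. e n > 0" "e \<longlonglongrightarrow> 0"
  shows "hausdorff_convergent G"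
proof -
  define L where "L = (\<Inter>n\<in>{n. odd n}. G n)"
  have L: "L \<in> C0"
    using C0 unfolding L_def C0_def by (auto intro!: convex_INT closed_INT)
  have cl: "closed (G n)" "closed L" for n
    using C0[of n] L by (auto simp: C0_def)
  have even_L: "G n \<subseteq> L" if "even n" for n
    unfolding L_def
  proof (rule INT_greatest)
    fix m :: nat assume "m \<in> {n. odd n}"
    then show "G n \<subseteq> G m"
      using even[OF that, of "m - n"] odd[of m "n - m"] by (cases "n \<le> m") auto
  qed
  have odd_L: "L \<subseteq> G n" if "odd n" for n
    using that unfolding L_def by auto
  have dist_le: "hausdorff_dist (G n) L \<le> ereal (e n)" if "n \<ge> N" for n
  proof (rule hausdorff_dist_le)
    have near: "(\<forall>x\<in>G (Suc n). \<exists>y\<in>G n. dist x y \<le> e n) \<and>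
                (\<forall>x\<in>G n. \<exists>y\<in>G (Suc n). dist x y \<le> e n)"
      using close[OF that] by (auto simp: mem_msum_cball[OF cl(1)] subset_iff)
    have refl: "\<exists>y\<in>M. dist x y \<le> e n" if "x \<in> M" for x M
      using that e(1)[of n] by (intro bexI[of _ x]) auto
    show "G n \<subseteq> msum L (cball 0 (e n))"
    proof (cases "even n")
      case True
      then show ?thesis
        using refl[of _ L, OF subsetD[OF even_L[OF True]]] by (auto simp: mem_msum_cball[OF cl(2)])
    next
      case False
      then have "G (Suc n) \<subseteq> L" by (simp add: even_L)
      then show ?thesis
        using near by (fastforce simp: mem_msum_cball[OF cl(2)])
    qed
    show "L \<subseteq> msum (G n) (cball 0 (e n))"
    proof (cases "even n")
      case True
      then have "L \<subseteq> G (Suc n)" by (simp add: odd_L)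
      then show ?thesis
        using near by (fastforce simp: mem_msum_cball[OF cl(1)])
    next
      case False
      then show ?thesis
        using refl[of _ "G n", OF subsetD[OF odd_L[OF False]]]
        by (auto simp: mem_msum_cball[OF cl(1)])
    qed
  qed (rule e)
  have "(\<lambda>n. hausdorff_dist (G n) L) \<longlonglongrightarrow> 0"
  proof (rule tendsto_sandwich[where f = "\<lambda>_. 0" and h = "\<lambda>n. ereal (e n)"])
    show "(\<lambda>n. ereal (e n)) \<longlonglongrightarrow> 0"
      using e(2) by (simp add: zero_ereal_def)
    show "\<forall>\<^sub>F n in sequentially. hausdorff_dist (G n) L \<le> ereal (e n)"
      using dist_le by (auto simp: eventually_sequentially)
  qed (auto simp: hausdorff_dist_nonneg)
  with L show ?thesis
    unfolding hausdorff_convergent_def by blast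
qed

section \<open>Contraction and the necessary norm bound\<close>

text \<open>If \<open>L\<close> lies in the \<open>e\<close>-neighbourhood of \<open>M\<close>, then for \<open>u\<close> in the image of \<open>M\<close> the bound
  \<open>1\<close> on \<open>K + M\<close> weakens to \<open>1 + a e\<close> on \<open>K + L\<close>; thus \<open>u / (1 + a e)\<close> is in the image of
  \<open>L\<close>.\<close>

lemma cf_step_contraction:
  fixes K L M :: "'a::euclidean_space set"
  assumes "closed M" and LM: "L \<subseteq> msum M (cball 0 e)" and "e \<ge> 0"
    and a: "cf_step K M \<subseteq> cball 0 a"
  shows "cf_step K M \<subseteq> msum (cf_step K L) (cball 0 (a\<^sup>2 * e))"
proof
  fix u assume u: "u \<in> cf_step K M"
  then have norm_u: "norm u \<le> a" using a by auto
  then have "0 \<le> a" using norm_ge_zero[of u] by linarith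
  with \<open>e \<ge> 0\<close> have ae: "0 \<le> a * e" "0 \<le> a" by simp_all
  define v where "v = u /\<^sub>R (1 + a * e)"
  have "v \<in> cf_step K L"
    unfolding cf_step_def polar_msum
  proof (intro CollectI ballI)
    fix x y assume "x \<in> K" "y \<in> L"
    then obtain z where z: "z \<in> M" "norm (y - z) \<le> e"
      using LM mem_msum_cball[OF \<open>closed M\<close>] by (fastforce simp: dist_norm)
    have "u \<bullet> (y - z) \<le> norm u * norm (y - z)"
      by (rule norm_cauchy_schwarz)
    also have "\<dots> \<le> a * e"
      using norm_u z(2) ae by (intro mult_mono) auto
    finally have "u \<bullet> y \<le> u \<bullet> z + a * e"
      by (simp add: inner_diff_right)
    moreover have "u \<bullet> x + u \<bullet> z \<le> 1"
      using u \<open>x \<in> K\<close> z(1) unfolding cf_step_def polar_msum by blast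
    ultimately have "u \<bullet> x + u \<bullet> y \<le> 1 + a * e"
      by linarith
    moreover have "v \<bullet> x + v \<bullet> y = (u \<bullet> x + u \<bullet> y) / (1 + a * e)"
      by (simp add: v_def divide_inverse algebra_simps)
    ultimately show "v \<bullet> x + v \<bullet> y \<le> 1"
      using ae by simp
  qed
  moreover have "dist u v \<le> a\<^sup>2 * e"
  proof -
    have "1 - inverse (1 + a * e) = a * e / (1 + a * e)"
      using ae by (simp add: field_simps)
    then have "u - v = (a * e / (1 + a * e)) *\<^sub>R u"
      by (metis scaleR_left_diff_distrib scaleR_one v_def)
    then have "dist u v = a * e / (1 + a * e) * norm u"
      using ae by (simp add: dist_norm)
    also have "\<dots> \<le> (a * e) * a"
      using ae norm_u by (intro mult_mono) (auto simp: field_simps)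
    finally show ?thesis
      by (simp add: power2_eq_square mult_ac)
  qed
  moreover have "closed (cf_step K L)"
    by (simp add: cf_step_def closed_polar)
  ultimately show "u \<in> msum (cf_step K L) (cball 0 (a\<^sup>2 * e))"
    by (auto simp: mem_msum_cball)
qed

text \<open>Take \<open>y \<in> L\<close> within \<open>r/2\<close> of \<open>u\<close> and the point \<open>x = r u / |u|\<close> of \<open>K\<close>.
  Then \<open>1 \<ge> \<langle>u, x + y\<rangle> \<ge> r |u| + |u|\<^sup>2 - (r/2) |u|\<close>.\<close>

lemma cf_step_norm_bound:
  fixes K L :: "'a::euclidean_space set"
  assumes r: "r > 0" "cball 0 r \<subseteq> K"
    and u: "u \<in> cf_step K L" and near: "y \<in> L" "dist u y \<le> r / 2"
  shows "(norm u)\<^sup>2 + r / 2 * norm u \<le> 1"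
proof -
  define x where "x = r *\<^sub>R sgn u"
  have "x \<in> K"
    using r by (intro subsetD[OF r(2)]) (auto simp: x_def norm_sgn)
  then have "u \<bullet> x + u \<bullet> y \<le> 1"
    using u near(1) unfolding cf_step_def polar_msum by blast
  moreover have "u \<bullet> x = r * norm u"
    by (cases "u = 0") (simp_all add: x_def sgn_div_norm dot_square_norm power2_eq_square)
  moreover have "u \<bullet> (u - y) \<le> norm u * (r / 2)"
    using near(2) by (intro order_trans[OF norm_cauchy_schwarz] mult_left_mono)
      (auto simp: dist_norm)
  ultimately show ?thesis
    by (simp add: inner_diff_right dot_square_norm algebra_simps)
qed

section \<open>The convergence criterion\<close>

lemma hausdorff_convergent_consecutive_close:
  fixes F :: "nat \<Rightarrow> 'a::euclidean_space set"
  assumes "hausdorff_convergent F" and cl: "\<And>n. n \<ge> 1 \<Longrightarrow> closed (F n)" and "e > 0"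
  shows "\<exists>N. \<forall>n\<ge>N. \<forall>u\<in>F (Suc n). \<exists>y\<in>F n. dist u y \<le> e"
proof -
  obtain L where L: "L \<in> C0" and lim: "(\<lambda>n. hausdorff_dist (F n) L) \<longlonglongrightarrow> 0"
    using assms(1) unfolding hausdorff_convergent_def by blast
  have "\<forall>\<^sub>F n in sequentially. hausdorff_dist (F n) L < ereal (e / 2)"
    by (rule order_tendstoD(2)[OF lim]) (use \<open>e > 0\<close> in auto)
  then obtain N where N: "\<And>n. n \<ge> N \<Longrightarrow> hausdorff_dist (F n) L < ereal (e / 2)"
    by (auto simp: eventually_sequentially)
  have clL: "closed L" using L by (simp add: C0_def)
  have "\<exists>y\<in>F n. dist u y \<le> e" if n: "n \<ge> max 1 N" and u: "u \<in> F (Suc n)" for n u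
  proof -
    obtain z where z: "z \<in> L" "dist u z \<le> e / 2"
      using hausdorff_dist_lessD(1)[OF N[of "Suc n"] cl clL] n u by auto
    obtain y where "y \<in> F n" "dist z y \<le> e / 2"
      using hausdorff_dist_lessD(2)[OF N[of n] cl clL] n z(1) by auto
    with z(2) show ?thesis
      by (intro bexI[of _ y]) (use dist_triangle[of u y z] in auto)
  qed
  then show ?thesis by blast
qed

lemma funpow_cf_step_convergent:
  fixes K :: "'a::euclidean_space set"
  assumes N: "odd N" "(cf_step K ^^ N) {0} \<subseteq> cball 0 a" and "0 < a" "a < 1"
  shows "hausdorff_convergent (\<lambda>n. (cf_step K ^^ n) {0})"
proof -
  define G where "G n = (cf_step K ^^ n) {0}" for n
  have step: "G (Suc n) = cf_step K (G n)" for n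
    by (simp add: G_def)
  have alt: "even n \<Longrightarrow> G n \<subseteq> G (n + j)" "odd n \<Longrightarrow> G (n + j) \<subseteq> G n" for n j
    using funpow_cf_step_alternating[of n K j] by (auto simp: G_def)
  have C0: "G n \<in> C0" for n
    unfolding G_def by (rule funpow_cf_step_C0)
  then have cl: "closed (G n)" and zero: "0 \<in> G n" for n
    by (auto simp: C0_def)
  have bound: "G n \<subseteq> cball 0 a" if "n \<ge> N" for n
    using alt(2)[OF N(1), of "n - N"] N(2) that by (auto simp: G_def)
  have close: "G (Suc (N + m)) \<subseteq> msum (G (N + m)) (cball 0 ((a\<^sup>2) ^ m)) \<and>
               G (N + m) \<subseteq> msum (G (Suc (N + m))) (cball 0 ((a\<^sup>2) ^ m))" for m
  proof (induction m)
    case 0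
    \<comment> \<open>Both sets contain the origin and lie in the unit ball.\<close>
    have "\<exists>y\<in>G k. dist x y \<le> 1" if "x \<in> G n" "n \<ge> N" for x n k
      using bound[OF that(2)] that(1) zero[of k] \<open>a < 1\<close> by (intro bexI[of _ 0]) auto
    then show ?case
      by (auto simp: mem_msum_cball[OF cl])
  next
    case (Suc m)
    have eq: "(a\<^sup>2) ^ Suc m = a\<^sup>2 * (a\<^sup>2) ^ m" by simp
    have bounds: "cf_step K (G (N + m)) \<subseteq> cball 0 a" "cf_step K (G (Suc (N + m))) \<subseteq> cball 0 a"
      using bound[of "Suc (N + m)"] bound[of "Suc (Suc (N + m))"] by (simp_all add: step)
    show ?case
      unfolding eq add_Suc_right
      using cf_step_contraction[OF cl conjunct1[OF Suc] _ bounds(1)]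
        cf_step_contraction[OF cl conjunct2[OF Suc] _ bounds(2)]
      by (simp add: step)
  qed
  have "hausdorff_convergent G"
  proof (rule alternating_hausdorff_convergent[where N = N and e = "\<lambda>n. (a\<^sup>2) ^ (n - N)"])
    show "G (Suc n) \<subseteq> msum (G n) (cball 0 ((a\<^sup>2) ^ (n - N))) \<and>
          G n \<subseteq> msum (G (Suc n)) (cball 0 ((a\<^sup>2) ^ (n - N)))" if "n \<ge> N" for n
      using close[of "n - N"] that by simp
    have "(\<lambda>m. (a\<^sup>2) ^ m) \<longlonglongrightarrow> 0"
      using \<open>0 < a\<close> \<open>a < 1\<close> by (intro LIMSEQ_realpow_zero) (auto simp: power_less_one_iff)
    then have "(\<lambda>m. (a\<^sup>2) ^ (m + N - N)) \<longlonglongrightarrow> 0" by simp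
    then show "(\<lambda>n. (a\<^sup>2) ^ (n - N)) \<longlonglongrightarrow> 0"
      by (rule LIMSEQ_offset)
  qed (use C0 alt \<open>0 < a\<close> in auto)
  then show ?thesis by (simp add: G_def[abs_def])
qed

theorem theorem4p3:
  fixes K :: "(real ^ 'd) set"
  assumes "closed K" and "convex K" and "0 \<in> interior K"
  shows "hausdorff_convergent (const_cf K) \<longleftrightarrow>
    (\<exists>k\<ge>1. \<exists>a::real. 0 \<le> a \<and> a < 1 \<and> const_cf K (2 * k - 1) \<subseteq> cball 0 a)"
proof
  have orbit: "const_cf K n = (cf_step K ^^ n) {0}" if "n \<ge> 1" for n
    using const_cf_eq_funpow[of K "n - 1"] that by simp
  {
    assume conv: "hausdorff_convergent (const_cf K)"
    obtain r where r: "r > 0" "cball 0 r \<subseteq> K"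
      using assms(3) by (auto simp: mem_interior_cball)
    have "closed (const_cf K n)" if "n \<ge> 1" for n
      using funpow_cf_step_C0[of n K] by (simp add: orbit[OF that] C0_def)
    then obtain N where N: "\<And>n u. n \<ge> N \<Longrightarrow> u \<in> const_cf K (Suc n) \<Longrightarrow>
        \<exists>y\<in>const_cf K n. dist u y \<le> r / 2"
      using hausdorff_convergent_consecutive_close[OF conv, of "r / 2"] r(1)
      by (metis half_gt_zero)
    define n where "n = 2 * Suc N"
    \<comment> \<open>If \<open>t \<ge> 1/2\<close> and \<open>t\<^sup>2 + r t / 2 \<le> 1\<close>, then \<open>t\<^sup>2 \<le> 1 - r / 4\<close>.\<close>
    define a where "a = sqrt (max (1 / 4) (1 - r / 4))"
    have "const_cf K (Suc n) \<subseteq> cball 0 a"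
    proof
      fix u assume u: "u \<in> const_cf K (Suc n)"
      then obtain y where y: "y \<in> const_cf K n" "dist u y \<le> r / 2"
        using N[of n u] by (auto simp: n_def)
      have "u \<in> cf_step K (const_cf K n)"
        using u by (simp add: orbit n_def)
      then have *: "(norm u)\<^sup>2 + r / 2 * norm u \<le> 1"
        using cf_step_norm_bound[OF r] y by blast
      have "(norm u)\<^sup>2 \<le> max (1 / 4) (1 - r / 4)"
      proof (cases "norm u \<le> 1 / 2")
        case True
        then have "(norm u)\<^sup>2 \<le> (1 / 2)\<^sup>2" by (intro power_mono) auto
        then show ?thesis by (simp add: power2_eq_square)
      next
        case False
        then have "r / 2 * (1 / 2) \<le> r / 2 * norm u"
          using r(1) by (intro mult_left_mono) auto
        with * show ?thesis by simp
      qed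
      then show "u \<in> cball 0 a"
        by (simp add: a_def real_le_rsqrt)
    qed
    moreover have "0 \<le> a" "a < 1"
      using r(1) by (auto simp: a_def)
    moreover have "Suc n = 2 * (N + 2) - 1"
      by (simp add: n_def)
    ultimately show "\<exists>k\<ge>1. \<exists>a::real. 0 \<le> a \<and> a < 1 \<and> const_cf K (2 * k - 1) \<subseteq> cball 0 a"
      by (intro exI[of _ "N + 2"]) auto
  }
  {
    assume "\<exists>k\<ge>1. \<exists>a::real. 0 \<le> a \<and> a < 1 \<and> const_cf K (2 * k - 1) \<subseteq> cball 0 a"
    then obtain k a where k: "k \<ge> 1" and a: "0 \<le> a" "a < (1::real)"
      "const_cf K (2 * k - 1) \<subseteq> cball 0 a" by blast
    \<comment> \<open>Enlarging \<open>a\<close> to at least \<open>1/2\<close> keeps the geometric distance bounds positive.\<close>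
    have "(cf_step K ^^ (2 * k - 1)) {0} \<subseteq> cball 0 (max a (1 / 2))"
      using a(3) k by (auto simp: orbit)
    then have "hausdorff_convergent (\<lambda>n. (cf_step K ^^ n) {0})"
      using k a(2) by (intro funpow_cf_step_convergent[of "2 * k - 1" K "max a (1 / 2)"]) auto
    then obtain L where L: "L \<in> C0" "(\<lambda>n. hausdorff_dist ((cf_step K ^^ n) {0}) L) \<longlonglongrightarrow> 0"
      unfolding hausdorff_convergent_def by blast
    \<comment> \<open>The two sequences may differ at index \<open>0\<close>, where \<open>const_cf\<close> is unspecified.\<close>
    have "\<forall>\<^sub>F n in sequentially. hausdorff_dist ((cf_step K ^^ n) {0}) L =
        hausdorff_dist (const_cf K n) L"
      using eventually_ge_at_top[of 1] by eventually_elim (simp add: orbit)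
    with L show "hausdorff_convergent (const_cf K)"
      unfolding hausdorff_convergent_def by (blast intro: Lim_transform_eventually)
  }
qed

end
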